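(* Let $K$ be a field and let $M$ be a Lie $K$-algebra. Let $M\otimes M$ be the non-abelian tensor product of $M$ with itself using the adjoint action, and let $(M\otimes M,M,\cdot,\partial)$ be the crossed module of Lie $K$-algebras whose action and boundary map are given on generators by $m\cdot(m_1\otimes m_2)=[m,m_1]\otimes m_2+m_1\otimes[m,m_2]$ and $\partial(m_1\otimes m_2)=[m_1,m_2]$. Then the $K$-bilinear map $\{-,-\}\colon M\times M\to M\otimes M$ defined by $\{m_1,m_2\}=m_1\otimes m_2$ is a braiding on the crossed module of Lie $K$-algebras $(M\otimes M,M,\cdot,\partial)$.
   Context: The non-abelian tensor product $M\otimes M$ (Ellis), for $M$ acting on itself by the adjoint action, is the Lie $K$-algebra generated by symbols $m\otimes n$ ($m,n\in M$) subject to the relations, for $\lambda\in K$ and elements of $M$: $\lambda(m\otimes n)=\lambda m\otimes n=m\otimes\lambda n$; $(m+m')\otimes n=m\otimes n+m'\otimes n$; $m\otimes(n+n')=m\otimes n+m\otimes n'$; $[m_1,m_2]\otimes m_3=m_1\otimes[m_2,m_3]-m_2\otimes[m_1,m_3]$; $m_1\otimes[m_2,m_3]=[m_3,m_1]\otimes m_2-[m_2,m_1]\otimes m_3$; $[(m_1\otimes m_2),(m_3\otimes m_4)]=[m_1,m_2]\otimes[m_3,m_4]$. A Lie action of a Lie algebra $N$ on a Lie algebra $M$ is a $K$-bilinear map $\cdot\colon N\times M\to M$ with $[n,n']\cdot m=n\cdot(n'\cdot m)-n'\cdot(n\cdot m)$ and $n\cdot[m,m']=[n\cdot m,m']+[m,n\cdot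 m']$. A crossed module of Lie $K$-algebras $(M,N,\cdot,\partial)$ consists of Lie algebras $M,N$, a Lie action $\cdot$ of $N$ on $M$ and a Lie homomorphism $\partial\colon M\to N$ with $\partial(n\cdot m)=[n,\partial(m)]$ and $\partial(m)\cdot m'=[m,m']$. It is a known result of Ellis that $(M\otimes M,M,\cdot,\partial)$ with the formulas in the claim is a well-defined crossed module of Lie $K$-algebras. A braiding on a crossed module of Lie $K$-algebras $(M,N,\cdot,\partial)$ is a $K$-bilinear map $\{-,-\}\colon N\times N\to M$ such that for all $m,m'\in M$, $n,n',n''\in N$: $\partial\{n,n'\}=[n,n']$; $\{\partial m,\partial m'\}=[m,m']$; $\{\partial m,n\}=-n\cdot m$; $\{n,\partial m\}=n\cdot m$; $\{n,[n',n'']\}=\{[n,n'],n''\}-\{[n,n''],n'\}$; $\{[n,n'],n''\}=\{n,[n',n'']\}-\{n',[n,n'']\}$. *)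

theory Defs
  imports "HOL-Algebra.Module"
begin

section \<open>Lie algebras over a field\<close>

definition bilinear_map ::
  "('k, 'r) ring_scheme \<Rightarrow> ('k, 'a, 'x) module_scheme \<Rightarrow> ('k, 'b, 'y) module_scheme
    \<Rightarrow> ('k, 'c, 'z) module_scheme \<Rightarrow> ('a \<Rightarrow> 'b \<Rightarrow> 'c) \<Rightarrow> bool" where
  "bilinear_map K U V W f \<longleftrightarrow>
     (\<forall>u\<in>carrier U. \<forall>v\<in>carrier V. f u v \<in> carrier W) \<and>
     (\<forall>u\<in>carrier U. \<forall>u'\<in>carrier U. \<forall>v\<in>carrier V.
        f (u \<oplus>\<^bsub>U\<^esub> u') v = f u v \<oplus>\<^bsub>W\<^esub> f u' v) \<and>
     (\<forall>u\<in>carrier U. \<forall>v\<in>carrier V. \<forall>v'\<in>carrier V.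
        f u (v \<oplus>\<^bsub>V\<^esub> v') = f u v \<oplus>\<^bsub>W\<^esub> f u v') \<and>
     (\<forall>c\<in>carrier K. \<forall>u\<in>carrier U. \<forall>v\<in>carrier V.
        f (c \<odot>\<^bsub>U\<^esub> u) v = c \<odot>\<^bsub>W\<^esub> f u v \<and>
        f u (c \<odot>\<^bsub>V\<^esub> v) = c \<odot>\<^bsub>W\<^esub> f u v)"

text \<open>As for every module record of the library, the inherited fields \<open>mult\<close> and \<open>one\<close>
  play no role; the Lie bracket has a field of its own.\<close>

record ('k, 'a) lie_alg = "('k, 'a) module" +
  lie_bracket :: "'a \<Rightarrow> 'a \<Rightarrow> 'a"  (\<open>(\<open>notation=\<open>mixfix lie_bracket\<close>\<close>\<lbrakk>_,/ _\<rbrakk>\<index>)\<close>)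

locale lie_algebra = field K + module K L
  for K :: "('k, 'r) ring_scheme" (structure)
    and L :: "('k, 'a, 'b) lie_alg_scheme" (structure) +
  assumes bracket_bilinear: "bilinear_map K L L L (lie_bracket L)"
    and bracket_self: "x \<in> carrier L \<Longrightarrow> \<lbrakk>x, x\<rbrakk>\<^bsub>L\<^esub> = \<zero>\<^bsub>L\<^esub>"
    and jacobi: "\<lbrakk> x \<in> carrier L; y \<in> carrier L; z \<in> carrier L \<rbrakk> \<Longrightarrow>
      \<lbrakk>x, \<lbrakk>y, z\<rbrakk>\<^bsub>L\<^esub>\<rbrakk>\<^bsub>L\<^esub> \<oplus>\<^bsub>L\<^esub> \<lbrakk>y, \<lbrakk>z, x\<rbrakk>\<^bsub>L\<^esub>\<rbrakk>\<^bsub>L\<^esub> \<oplus>\<^bsub>L\<^esub> \<lbrakk>z, \<lbrakk>x, y\<rbrakk>\<^bsub>L\<^esub>\<rbrakk>\<^bsub>L\<^esub> = \<zero>\<^bsub>L\<^esub>"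

definition lie_hom ::
  "('k, 'r) ring_scheme \<Rightarrow> ('k, 'a, 'x) lie_alg_scheme \<Rightarrow> ('k, 'b, 'y) lie_alg_scheme
    \<Rightarrow> ('a \<Rightarrow> 'b) set" where
  "lie_hom K L L' = {f. f \<in> carrier L \<rightarrow> carrier L' \<and>
     (\<forall>x\<in>carrier L. \<forall>y\<in>carrier L. f (x \<oplus>\<^bsub>L\<^esub> y) = f x \<oplus>\<^bsub>L'\<^esub> f y) \<and>
     (\<forall>c\<in>carrier K. \<forall>x\<in>carrier L. f (c \<odot>\<^bsub>L\<^esub> x) = c \<odot>\<^bsub>L'\<^esub> f x) \<and>
     (\<forall>x\<in>carrier L. \<forall>y\<in>carrier L. f \<lbrakk>x, y\<rbrakk>\<^bsub>L\<^esub> = \<lbrakk>f x, f y\<rbrakk>\<^bsub>L'\<^esub>)}"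


section \<open>Crossed modules and braidings\<close>

locale lie_action = M: lie_algebra K M + N: lie_algebra K N
  for K :: "('k, 'r) ring_scheme"
    and N :: "('k, 'n, 'y) lie_alg_scheme"
    and M :: "('k, 'm, 'x) lie_alg_scheme"
    and act :: "'n \<Rightarrow> 'm \<Rightarrow> 'm"  (infixr \<open>\<cdot>\<close> 75) +
  assumes act_bilinear: "bilinear_map K N M M act"
    and bracket_act: "\<lbrakk> n \<in> carrier N; n' \<in> carrier N; m \<in> carrier M \<rbrakk> \<Longrightarrow>
      \<lbrakk>n, n'\<rbrakk>\<^bsub>N\<^esub> \<cdot> m = n \<cdot> n' \<cdot> m \<ominus>\<^bsub>M\<^esub> n' \<cdot> n \<cdot> m"
    and act_bracket: "\<lbrakk> n \<in> carrier N; m \<in> carrier M; m' \<in> carrier M \<rbrakk> \<Longrightarrow>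
      n \<cdot> \<lbrakk>m, m'\<rbrakk>\<^bsub>M\<^esub> = \<lbrakk>n \<cdot> m, m'\<rbrakk>\<^bsub>M\<^esub> \<oplus>\<^bsub>M\<^esub> \<lbrakk>m, n \<cdot> m'\<rbrakk>\<^bsub>M\<^esub>"

locale lie_crossed_module = lie_action K N M act
  for K :: "('k, 'r) ring_scheme"
    and M :: "('k, 'm, 'x) lie_alg_scheme"
    and N :: "('k, 'n, 'y) lie_alg_scheme"
    and act :: "'n \<Rightarrow> 'm \<Rightarrow> 'm"  (infixr \<open>\<cdot>\<close> 75)
    and bd :: "'m \<Rightarrow> 'n"  (\<open>\<partial>\<close>) +
  assumes bd_hom: "\<partial> \<in> lie_hom K M N"
    and bd_act: "\<lbrakk> n \<in> carrier N; m \<in> carrier M \<rbrakk> \<Longrightarrow> \<partial> (n \<cdot> m) = \<lbrakk>n, \<partial> m\<rbrakk>\<^bsub>N\<^esub>"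
    and peiffer: "\<lbrakk> m \<in> carrier M; m' \<in> carrier M \<rbrakk> \<Longrightarrow> \<partial> m \<cdot> m' = \<lbrakk>m, m'\<rbrakk>\<^bsub>M\<^esub>"

locale lie_braiding = lie_crossed_module K M N act bd
  for K :: "('k, 'r) ring_scheme"
    and M :: "('k, 'm, 'x) lie_alg_scheme"
    and N :: "('k, 'n, 'y) lie_alg_scheme"
    and act :: "'n \<Rightarrow> 'm \<Rightarrow> 'm"  (infixr \<open>\<cdot>\<close> 75)
    and bd :: "'m \<Rightarrow> 'n"  (\<open>\<partial>\<close>)
    and br :: "'n \<Rightarrow> 'n \<Rightarrow> 'm" +
  assumes br_bilinear: "bilinear_map K N N M br"
    and bd_br: "\<lbrakk> n \<in> carrier N; n' \<in> carrier N \<rbrakk> \<Longrightarrow> \<partial> (br n n') = \<lbrakk>n, n'\<rbrakk>\<^bsub>N\<^esub>"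
    and br_bd_bd: "\<lbrakk> m \<in> carrier M; m' \<in> carrier M \<rbrakk> \<Longrightarrow> br (\<partial> m) (\<partial> m') = \<lbrakk>m, m'\<rbrakk>\<^bsub>M\<^esub>"
    and br_bd_left: "\<lbrakk> m \<in> carrier M; n \<in> carrier N \<rbrakk> \<Longrightarrow> br (\<partial> m) n = \<ominus>\<^bsub>M\<^esub> (n \<cdot> m)"
    and br_bd_right: "\<lbrakk> m \<in> carrier M; n \<in> carrier N \<rbrakk> \<Longrightarrow> br n (\<partial> m) = n \<cdot> m"
    and br_bracket_right: "\<lbrakk> n \<in> carrier N; n' \<in> carrier N; n'' \<in> carrier N \<rbrakk> \<Longrightarrow>
      br n \<lbrakk>n', n''\<rbrakk>\<^bsub>N\<^esub> = br \<lbrakk>n, n'\<rbrakk>\<^bsub>N\<^esub> n'' \<ominus>\<^bsub>M\<^esub> br \<lbrakk>n, n''\<rbrakk>\<^bsub>N\<^esub> n'"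
    and br_bracket_left: "\<lbrakk> n \<in> carrier N; n' \<in> carrier N; n'' \<in> carrier N \<rbrakk> \<Longrightarrow>
      br \<lbrakk>n, n'\<rbrakk>\<^bsub>N\<^esub> n'' = br n \<lbrakk>n', n''\<rbrakk>\<^bsub>N\<^esub> \<ominus>\<^bsub>M\<^esub> br n' \<lbrakk>n, n''\<rbrakk>\<^bsub>N\<^esub>"


section \<open>Lie algebras given by generators and relations\<close>

datatype ('k, 'g) lie_term =
    Gen 'g
  | Zero
  | Plus "('k, 'g) lie_term" "('k, 'g) lie_term"
  | Scale 'k "('k, 'g) lie_term"
  | Brack "('k, 'g) lie_term" "('k, 'g) lie_term"

inductive_set lie_terms :: "('k, 'r) ring_scheme \<Rightarrow> 'g set \<Rightarrow> ('k, 'g) lie_term set"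
  for K (structure) and X where
  Gen: "x \<in> X \<Longrightarrow> Gen x \<in> lie_terms K X"
| Zero: "Zero \<in> lie_terms K X"
| Plus: "s \<in> lie_terms K X \<Longrightarrow> t \<in> lie_terms K X \<Longrightarrow> Plus s t \<in> lie_terms K X"
| Scale: "c \<in> carrier K \<Longrightarrow> t \<in> lie_terms K X \<Longrightarrow> Scale c t \<in> lie_terms K X"
| Brack: "s \<in> lie_terms K X \<Longrightarrow> t \<in> lie_terms K X \<Longrightarrow> Brack s t \<in> lie_terms K X"

text \<open>The least congruence on the terms that contains the relations \<open>R\<close> and makes the quotient
  a Lie algebra over \<open>K\<close>. The additive inverse of \<open>t\<close> is \<open>(-1) t\<close>.\<close>

inductive_set lie_cong ::
  "('k, 'r) ring_scheme \<Rightarrow> 'g set \<Rightarrow> (('k, 'g) lie_term \<times> ('k, 'g) lie_term) set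
    \<Rightarrow> (('k, 'g) lie_term \<times> ('k, 'g) lie_term) set"
  for K (structure) and X and R where
  rel: "(s, t) \<in> R \<Longrightarrow> s \<in> lie_terms K X \<Longrightarrow> t \<in> lie_terms K X \<Longrightarrow> (s, t) \<in> lie_cong K X R"
| refl: "t \<in> lie_terms K X \<Longrightarrow> (t, t) \<in> lie_cong K X R"
| sym: "(s, t) \<in> lie_cong K X R \<Longrightarrow> (t, s) \<in> lie_cong K X R"
| trans: "(s, t) \<in> lie_cong K X R \<Longrightarrow> (t, u) \<in> lie_cong K X R \<Longrightarrow> (s, u) \<in> lie_cong K X R"
| plus_cong: "(s, s') \<in> lie_cong K X R \<Longrightarrow> (t, t') \<in> lie_cong K X R \<Longrightarrow>
    (Plus s t, Plus s' t') \<in> lie_cong K X R"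
| scale_cong: "c \<in> carrier K \<Longrightarrow> (t, t') \<in> lie_cong K X R \<Longrightarrow>
    (Scale c t, Scale c t') \<in> lie_cong K X R"
| brack_cong: "(s, s') \<in> lie_cong K X R \<Longrightarrow> (t, t') \<in> lie_cong K X R \<Longrightarrow>
    (Brack s t, Brack s' t') \<in> lie_cong K X R"
| plus_assoc: "s \<in> lie_terms K X \<Longrightarrow> t \<in> lie_terms K X \<Longrightarrow> u \<in> lie_terms K X \<Longrightarrow>
    (Plus (Plus s t) u, Plus s (Plus t u)) \<in> lie_cong K X R"
| plus_comm: "s \<in> lie_terms K X \<Longrightarrow> t \<in> lie_terms K X \<Longrightarrow>
    (Plus s t, Plus t s) \<in> lie_cong K X R"
| plus_zero: "t \<in> lie_terms K X \<Longrightarrow> (Plus Zero t, t) \<in> lie_cong K X R"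
| plus_neg: "t \<in> lie_terms K X \<Longrightarrow> (Plus (Scale (\<ominus> \<one>) t) t, Zero) \<in> lie_cong K X R"
| scale_add_left: "c \<in> carrier K \<Longrightarrow> d \<in> carrier K \<Longrightarrow> t \<in> lie_terms K X \<Longrightarrow>
    (Scale (c \<oplus> d) t, Plus (Scale c t) (Scale d t)) \<in> lie_cong K X R"
| scale_add_right: "c \<in> carrier K \<Longrightarrow> s \<in> lie_terms K X \<Longrightarrow> t \<in> lie_terms K X \<Longrightarrow>
    (Scale c (Plus s t), Plus (Scale c s) (Scale c t)) \<in> lie_cong K X R"
| scale_mult: "c \<in> carrier K \<Longrightarrow> d \<in> carrier K \<Longrightarrow> t \<in> lie_terms K X \<Longrightarrow>
    (Scale (c \<otimes> d) t, Scale c (Scale d t)) \<in> lie_cong K X R"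
| scale_one: "t \<in> lie_terms K X \<Longrightarrow> (Scale \<one> t, t) \<in> lie_cong K X R"
| brack_add_left: "s \<in> lie_terms K X \<Longrightarrow> t \<in> lie_terms K X \<Longrightarrow> u \<in> lie_terms K X \<Longrightarrow>
    (Brack (Plus s t) u, Plus (Brack s u) (Brack t u)) \<in> lie_cong K X R"
| brack_add_right: "s \<in> lie_terms K X \<Longrightarrow> t \<in> lie_terms K X \<Longrightarrow> u \<in> lie_terms K X \<Longrightarrow>
    (Brack s (Plus t u), Plus (Brack s t) (Brack s u)) \<in> lie_cong K X R"
| brack_scale_left: "c \<in> carrier K \<Longrightarrow> s \<in> lie_terms K X \<Longrightarrow> t \<in> lie_terms K X \<Longrightarrow>
    (Brack (Scale c s) t, Scale c (Brack s t)) \<in> lie_cong K X R"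
| brack_scale_right: "c \<in> carrier K \<Longrightarrow> s \<in> lie_terms K X \<Longrightarrow> t \<in> lie_terms K X \<Longrightarrow>
    (Brack s (Scale c t), Scale c (Brack s t)) \<in> lie_cong K X R"
| brack_self: "t \<in> lie_terms K X \<Longrightarrow> (Brack t t, Zero) \<in> lie_cong K X R"
| brack_jacobi: "s \<in> lie_terms K X \<Longrightarrow> t \<in> lie_terms K X \<Longrightarrow> u \<in> lie_terms K X \<Longrightarrow>
    (Plus (Plus (Brack s (Brack t u)) (Brack t (Brack u s))) (Brack u (Brack s t)), Zero)
      \<in> lie_cong K X R"

definition lie_presented ::
  "('k, 'r) ring_scheme \<Rightarrow> 'g set \<Rightarrow> (('k, 'g) lie_term \<times> ('k, 'g) lie_term) set
    \<Rightarrow> ('k, ('k, 'g) lie_term set) lie_alg" where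
  "lie_presented K X R =
    \<lparr> carrier = lie_terms K X // lie_cong K X R,
      mult = undefined,
      one = undefined,
      zero = lie_cong K X R `` {Zero},
      add = (\<lambda>A B. \<Union>s\<in>A. \<Union>t\<in>B. lie_cong K X R `` {Plus s t}),
      smult = (\<lambda>c A. \<Union>t\<in>A. lie_cong K X R `` {Scale c t}),
      lie_bracket = (\<lambda>A B. \<Union>s\<in>A. \<Union>t\<in>B. lie_cong K X R `` {Brack s t}) \<rparr>"


section \<open>The non-abelian tensor square\<close>

text \<open>The symbol \<open>m \<otimes> n\<close> is the term \<open>Gen (m, n)\<close>, and a pair in the following set stands for
  the equation of its two components.\<close>

inductive_set tensor_rels ::
  "('k, 'r) ring_scheme \<Rightarrow> ('k, 'a, 'b) lie_alg_scheme
    \<Rightarrow> (('k, 'a \<times> 'a) lie_term \<times> ('k, 'a \<times> 'a) lie_term) set"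
  for K and M where
  scale_left: "c \<in> carrier K \<Longrightarrow> m \<in> carrier M \<Longrightarrow> n \<in> carrier M \<Longrightarrow>
    (Scale c (Gen (m, n)), Gen (c \<odot>\<^bsub>M\<^esub> m, n)) \<in> tensor_rels K M"
| scale_right: "c \<in> carrier K \<Longrightarrow> m \<in> carrier M \<Longrightarrow> n \<in> carrier M \<Longrightarrow>
    (Scale c (Gen (m, n)), Gen (m, c \<odot>\<^bsub>M\<^esub> n)) \<in> tensor_rels K M"
| add_left: "m \<in> carrier M \<Longrightarrow> m' \<in> carrier M \<Longrightarrow> n \<in> carrier M \<Longrightarrow>
    (Gen (m \<oplus>\<^bsub>M\<^esub> m', n), Plus (Gen (m, n)) (Gen (m', n))) \<in> tensor_rels K M"
| add_right: "m \<in> carrier M \<Longrightarrow> n \<in> carrier M \<Longrightarrow> n' \<in> carrier M \<Longrightarrow>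
    (Gen (m, n \<oplus>\<^bsub>M\<^esub> n'), Plus (Gen (m, n)) (Gen (m, n'))) \<in> tensor_rels K M"
| bracket_left: "m1 \<in> carrier M \<Longrightarrow> m2 \<in> carrier M \<Longrightarrow> m3 \<in> carrier M \<Longrightarrow>
    (Gen (\<lbrakk>m1, m2\<rbrakk>\<^bsub>M\<^esub>, m3),
     Plus (Gen (m1, \<lbrakk>m2, m3\<rbrakk>\<^bsub>M\<^esub>)) (Scale (\<ominus>\<^bsub>K\<^esub> \<one>\<^bsub>K\<^esub>) (Gen (m2, \<lbrakk>m1, m3\<rbrakk>\<^bsub>M\<^esub>))))
      \<in> tensor_rels K M"
| bracket_right: "m1 \<in> carrier M \<Longrightarrow> m2 \<in> carrier M \<Longrightarrow> m3 \<in> carrier M \<Longrightarrow>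
    (Gen (m1, \<lbrakk>m2, m3\<rbrakk>\<^bsub>M\<^esub>),
     Plus (Gen (\<lbrakk>m3, m1\<rbrakk>\<^bsub>M\<^esub>, m2)) (Scale (\<ominus>\<^bsub>K\<^esub> \<one>\<^bsub>K\<^esub>) (Gen (\<lbrakk>m2, m1\<rbrakk>\<^bsub>M\<^esub>, m3))))
      \<in> tensor_rels K M"
| bracket_tensor: "m1 \<in> carrier M \<Longrightarrow> m2 \<in> carrier M \<Longrightarrow> m3 \<in> carrier M \<Longrightarrow> m4 \<in> carrier M \<Longrightarrow>
    (Brack (Gen (m1, m2)) (Gen (m3, m4)), Gen (\<lbrakk>m1, m2\<rbrakk>\<^bsub>M\<^esub>, \<lbrakk>m3, m4\<rbrakk>\<^bsub>M\<^esub>)) \<in> tensor_rels K M"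

definition tensor_square ::
  "('k, 'r) ring_scheme \<Rightarrow> ('k, 'a, 'b) lie_alg_scheme
    \<Rightarrow> ('k, ('k, 'a \<times> 'a) lie_term set) lie_alg" where
  "tensor_square K M = lie_presented K (carrier M \<times> carrier M) (tensor_rels K M)"

definition tensor_class ::
  "('k, 'r) ring_scheme \<Rightarrow> ('k, 'a, 'b) lie_alg_scheme \<Rightarrow> ('k, 'a \<times> 'a) lie_term
    \<Rightarrow> ('k, 'a \<times> 'a) lie_term set" where
  "tensor_class K M t = lie_cong K (carrier M \<times> carrier M) (tensor_rels K M) `` {t}"

definition tensor ::
  "('k, 'r) ring_scheme \<Rightarrow> ('k, 'a, 'b) lie_alg_scheme \<Rightarrow> 'a \<Rightarrow> 'a
    \<Rightarrow> ('k, 'a \<times> 'a) lie_term set" where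
  "tensor K M m n = tensor_class K M (Gen (m, n))"

text \<open>A map given on generators extends to all terms: the action of \<open>m\<close> as a \<open>K\<close>-linear
  derivation, the boundary as a Lie homomorphism. Both then descend to the quotient.\<close>

fun act_term ::
  "('k, 'a, 'b) lie_alg_scheme \<Rightarrow> 'a \<Rightarrow> ('k, 'a \<times> 'a) lie_term \<Rightarrow> ('k, 'a \<times> 'a) lie_term" where
  "act_term M m (Gen (m1, m2)) = Plus (Gen (\<lbrakk>m, m1\<rbrakk>\<^bsub>M\<^esub>, m2)) (Gen (m1, \<lbrakk>m, m2\<rbrakk>\<^bsub>M\<^esub>))"
| "act_term M m Zero = Zero"
| "act_term M m (Plus s t) = Plus (act_term M m s) (act_term M m t)"
| "act_term M m (Scale c t) = Scale c (act_term M m t)"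
| "act_term M m (Brack s t) = Plus (Brack (act_term M m s) t) (Brack s (act_term M m t))"

fun bd_term :: "('k, 'a, 'b) lie_alg_scheme \<Rightarrow> ('k, 'a \<times> 'a) lie_term \<Rightarrow> 'a" where
  "bd_term M (Gen (m1, m2)) = \<lbrakk>m1, m2\<rbrakk>\<^bsub>M\<^esub>"
| "bd_term M Zero = \<zero>\<^bsub>M\<^esub>"
| "bd_term M (Plus s t) = bd_term M s \<oplus>\<^bsub>M\<^esub> bd_term M t"
| "bd_term M (Scale c t) = c \<odot>\<^bsub>M\<^esub> bd_term M t"
| "bd_term M (Brack s t) = \<lbrakk>bd_term M s, bd_term M t\<rbrakk>\<^bsub>M\<^esub>"

definition tensor_act ::
  "('k, 'r) ring_scheme \<Rightarrow> ('k, 'a, 'b) lie_alg_scheme \<Rightarrow> 'a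
    \<Rightarrow> ('k, 'a \<times> 'a) lie_term set \<Rightarrow> ('k, 'a \<times> 'a) lie_term set" where
  "tensor_act K M m A = (\<Union>t\<in>A. tensor_class K M (act_term M m t))"

definition tensor_bd ::
  "('k, 'a, 'b) lie_alg_scheme \<Rightarrow> ('k, 'a \<times> 'a) lie_term set \<Rightarrow> 'a" where
  "tensor_bd M A = the_elem (bd_term M ` A)"

end

theory Submission
  imports Defs
begin

text \<open>
  Everything reduces to two formulas: \<open>[x, y] = \<partial>x \<otimes> \<partial>y\<close> in \<open>M \<otimes> M\<close>, and
  \<open>m \<cdot> x = m \<otimes> \<partial>x\<close>, so that the action is well defined because \<open>\<partial>\<close> is. Both come from the
  derivation rule \<open>n \<otimes> [a, b] = [n, a] \<otimes> b + a \<otimes> [n, b]\<close>, which in turn needs the antisymmetry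
  \<open>[a, b] \<otimes> y = - (y \<otimes> [a, b])\<close>. With \<open>p = y \<otimes> [a, b]\<close>, \<open>q = a \<otimes> [b, y]\<close> and
  \<open>r = b \<otimes> [y, a]\<close>, the first bracket relation gives \<open>[a, b] \<otimes> y = q + r\<close>, and substituting it
  and its cyclic permutations into the second one gives \<open>p = (r + p) + (q + p)\<close>. Hence
  \<open>p + q + r = 0\<close> without dividing by \<open>2\<close>.
\<close>

section \<open>Identities in a Lie algebra\<close>

context lie_algebra
begin

lemmas abelian_simps =
  M.a_ac M.minus_eq M.minus_add M.minus_minus M.r_neg M.r_neg1 M.r_neg2

lemma bracket_closed [simp]:
  "x \<in> carrier L \<Longrightarrow> y \<in> carrier L \<Longrightarrow> \<lbrakk>x, y\<rbrakk>\<^bsub>L\<^esub> \<in> carrier L"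
  using bracket_bilinear by (simp add: bilinear_map_def)

lemma bracket_add_left:
  "\<lbrakk>x \<in> carrier L; y \<in> carrier L; z \<in> carrier L\<rbrakk> \<Longrightarrow>
    \<lbrakk>x \<oplus>\<^bsub>L\<^esub> y, z\<rbrakk>\<^bsub>L\<^esub> = \<lbrakk>x, z\<rbrakk>\<^bsub>L\<^esub> \<oplus>\<^bsub>L\<^esub> \<lbrakk>y, z\<rbrakk>\<^bsub>L\<^esub>"
  using bracket_bilinear by (simp add: bilinear_map_def)

lemma bracket_add_right:
  "\<lbrakk>x \<in> carrier L; y \<in> carrier L; z \<in> carrier L\<rbrakk> \<Longrightarrow>
    \<lbrakk>x, y \<oplus>\<^bsub>L\<^esub> z\<rbrakk>\<^bsub>L\<^esub> = \<lbrakk>x, y\<rbrakk>\<^bsub>L\<^esub> \<oplus>\<^bsub>L\<^esub> \<lbrakk>x, z\<rbrakk>\<^bsub>L\<^esub>"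
  using bracket_bilinear by (simp add: bilinear_map_def)

lemma bracket_smult_left:
  "\<lbrakk>c \<in> carrier K; x \<in> carrier L; y \<in> carrier L\<rbrakk> \<Longrightarrow>
    \<lbrakk>c \<odot>\<^bsub>L\<^esub> x, y\<rbrakk>\<^bsub>L\<^esub> = c \<odot>\<^bsub>L\<^esub> \<lbrakk>x, y\<rbrakk>\<^bsub>L\<^esub>"
  using bracket_bilinear by (simp add: bilinear_map_def)

lemma bracket_smult_right:
  "\<lbrakk>c \<in> carrier K; x \<in> carrier L; y \<in> carrier L\<rbrakk> \<Longrightarrow>
    \<lbrakk>x, c \<odot>\<^bsub>L\<^esub> y\<rbrakk>\<^bsub>L\<^esub> = c \<odot>\<^bsub>L\<^esub> \<lbrakk>x, y\<rbrakk>\<^bsub>L\<^esub>"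
  using bracket_bilinear by (simp add: bilinear_map_def)

lemma smult_minus_one: "x \<in> carrier L \<Longrightarrow> (\<ominus> \<one>) \<odot>\<^bsub>L\<^esub> x = \<ominus>\<^bsub>L\<^esub> x"
  by (simp add: smult_l_minus)

lemma bracket_zero_left: "x \<in> carrier L \<Longrightarrow> \<lbrakk>\<zero>\<^bsub>L\<^esub>, x\<rbrakk>\<^bsub>L\<^esub> = \<zero>\<^bsub>L\<^esub>"
  using bracket_smult_left[of \<zero> "\<zero>\<^bsub>L\<^esub>" x] by simp

lemma bracket_zero_right: "x \<in> carrier L \<Longrightarrow> \<lbrakk>x, \<zero>\<^bsub>L\<^esub>\<rbrakk>\<^bsub>L\<^esub> = \<zero>\<^bsub>L\<^esub>"
  using bracket_smult_right[of \<zero> x "\<zero>\<^bsub>L\<^esub>"] by simp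

lemma bracket_minus_left:
  "x \<in> carrier L \<Longrightarrow> y \<in> carrier L \<Longrightarrow> \<lbrakk>\<ominus>\<^bsub>L\<^esub> x, y\<rbrakk>\<^bsub>L\<^esub> = \<ominus>\<^bsub>L\<^esub> \<lbrakk>x, y\<rbrakk>\<^bsub>L\<^esub>"
  using bracket_smult_left[of "\<ominus> \<one>" x y] by (simp add: smult_minus_one)

lemma bracket_minus_right:
  "x \<in> carrier L \<Longrightarrow> y \<in> carrier L \<Longrightarrow> \<lbrakk>x, \<ominus>\<^bsub>L\<^esub> y\<rbrakk>\<^bsub>L\<^esub> = \<ominus>\<^bsub>L\<^esub> \<lbrakk>x, y\<rbrakk>\<^bsub>L\<^esub>"
  using bracket_smult_right[of "\<ominus> \<one>" x y] by (simp add: smult_minus_one)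

text \<open>Polarisation: expand \<open>[x + y, x + y] = 0\<close> and drop the squares, which
  vanish by \<open>bracket_self\<close>. No division by \<open>2\<close> occurs.\<close>

lemma bracket_antisym:
  assumes "x \<in> carrier L" "y \<in> carrier L"
  shows "\<lbrakk>x, y\<rbrakk>\<^bsub>L\<^esub> = \<ominus>\<^bsub>L\<^esub> \<lbrakk>y, x\<rbrakk>\<^bsub>L\<^esub>"
proof -
  have "\<lbrakk>x \<oplus>\<^bsub>L\<^esub> y, x \<oplus>\<^bsub>L\<^esub> y\<rbrakk>\<^bsub>L\<^esub> = \<lbrakk>x, y\<rbrakk>\<^bsub>L\<^esub> \<oplus>\<^bsub>L\<^esub> \<lbrakk>y, x\<rbrakk>\<^bsub>L\<^esub>"
    using assms bracket_self[of x] bracket_self[of y]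
    by (simp add: bracket_add_left bracket_add_right M.a_comm)
  then have "\<lbrakk>x, y\<rbrakk>\<^bsub>L\<^esub> \<oplus>\<^bsub>L\<^esub> \<lbrakk>y, x\<rbrakk>\<^bsub>L\<^esub> = \<zero>\<^bsub>L\<^esub>"
    using assms bracket_self[of "x \<oplus>\<^bsub>L\<^esub> y"] by simp
  then show ?thesis
    using assms by (metis M.minus_equality bracket_closed)
qed

text \<open>The Jacobi identity after flipping \<open>[z, x]\<close> and the outer bracket. This is
  the shape of the first bracket relation of the tensor square.\<close>

lemma bracket_bracket_left:
  assumes "x \<in> carrier L" "y \<in> carrier L" "z \<in> carrier L"
  shows "\<lbrakk>\<lbrakk>x, y\<rbrakk>\<^bsub>L\<^esub>, z\<rbrakk>\<^bsub>L\<^esub> = \<lbrakk>x, \<lbrakk>y, z\<rbrakk>\<^bsub>L\<^esub>\<rbrakk>\<^bsub>L\<^esub> \<ominus>\<^bsub>L\<^esub> \<lbrakk>y, \<lbrakk>x, z\<rbrakk>\<^bsub>L\<^esub>\<rbrakk>\<^bsub>L\<^esub>"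
proof -
  have "\<lbrakk>y, \<lbrakk>z, x\<rbrakk>\<^bsub>L\<^esub>\<rbrakk>\<^bsub>L\<^esub> = \<ominus>\<^bsub>L\<^esub> \<lbrakk>y, \<lbrakk>x, z\<rbrakk>\<^bsub>L\<^esub>\<rbrakk>\<^bsub>L\<^esub>"
    using assms bracket_antisym[of z x] by (simp add: bracket_minus_right)
  moreover have "\<lbrakk>\<lbrakk>x, y\<rbrakk>\<^bsub>L\<^esub>, z\<rbrakk>\<^bsub>L\<^esub> = \<ominus>\<^bsub>L\<^esub> \<lbrakk>z, \<lbrakk>x, y\<rbrakk>\<^bsub>L\<^esub>\<rbrakk>\<^bsub>L\<^esub>"
    using assms by (intro bracket_antisym) auto
  moreover have "\<ominus>\<^bsub>L\<^esub> \<lbrakk>z, \<lbrakk>x, y\<rbrakk>\<^bsub>L\<^esub>\<rbrakk>\<^bsub>L\<^esub> = \<lbrakk>x, \<lbrakk>y, z\<rbrakk>\<^bsub>L\<^esub>\<rbrakk>\<^bsub>L\<^esub> \<oplus>\<^bsub>L\<^esub> \<lbrakk>y, \<lbrakk>z, x\<rbrakk>\<^bsub>L\<^esub>\<rbrakk>\<^bsub>L\<^esub>"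
    using jacobi[OF assms] assms by (intro M.minus_equality) auto
  ultimately show ?thesis
    by (simp add: M.minus_eq)
qed

text \<open>The same identity rearranged, so that \<open>[x, _]\<close> appears as a
  derivation.\<close>

lemma bracket_bracket_right:
  assumes "x \<in> carrier L" "y \<in> carrier L" "z \<in> carrier L"
  shows "\<lbrakk>x, \<lbrakk>y, z\<rbrakk>\<^bsub>L\<^esub>\<rbrakk>\<^bsub>L\<^esub> = \<lbrakk>\<lbrakk>x, y\<rbrakk>\<^bsub>L\<^esub>, z\<rbrakk>\<^bsub>L\<^esub> \<oplus>\<^bsub>L\<^esub> \<lbrakk>y, \<lbrakk>x, z\<rbrakk>\<^bsub>L\<^esub>\<rbrakk>\<^bsub>L\<^esub>"
  using assms bracket_bracket_left[OF assms] by (simp add: abelian_simps)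

end


section \<open>The presented Lie algebra\<close>

locale lie_presentation = field K
  for K :: "('k, 'r) ring_scheme" (structure)
    and X :: "'g set"
    and R :: "(('k, 'g) lie_term \<times> ('k, 'g) lie_term) set"
begin

abbreviation "T \<equiv> lie_terms K X"
abbreviation "C \<equiv> lie_cong K X R"
abbreviation "P \<equiv> lie_presented K X R"
definition cls where "cls t = C `` {t}"

text \<open>The base rules carry membership in \<open>T\<close> as premises and the closure rules
  preserve it. Hence \<open>C\<close> is an equivalence on \<open>T\<close>, not on all
  terms.\<close>

lemma lie_cong_terms: "(s, t) \<in> C \<Longrightarrow> s \<in> T \<and> t \<in> T"
  by (induction rule: lie_cong.induct) (auto intro: lie_terms.intros)

lemma equiv_lie_cong: "equiv T C"
  by (rule equivI)
    (auto simp: refl_on_def sym_def trans_def dest: lie_cong_terms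
      intro: lie_cong.refl lie_cong.sym lie_cong.trans)

lemma cls_eqI: "(s, t) \<in> C \<Longrightarrow> cls s = cls t"
  unfolding cls_def by (rule equiv_class_eq[OF equiv_lie_cong])

lemma carrier_presented: "carrier P = cls ` T"
  by (auto simp: lie_presented_def quotient_def cls_def)

lemma cls_closed [simp]: "t \<in> T \<Longrightarrow> cls t \<in> carrier P"
  by (simp add: carrier_presented)

lemma cls_Zero: "cls Zero = \<zero>\<^bsub>P\<^esub>"
  by (simp add: lie_presented_def cls_def)

text \<open>The sum in the quotient is a union over all representatives; by \<open>plus_cong\<close>
  every member of that union is the same class. Brackets and scalars work alike.\<close>

lemma cls_Plus: "s \<in> T \<Longrightarrow> t \<in> T \<Longrightarrow> cls (Plus s t) = cls s \<oplus>\<^bsub>P\<^esub> cls t"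
  unfolding lie_presented_def cls_def
  by (simp, rule UN_equiv_class2[OF equiv_lie_cong equiv_lie_cong, symmetric])
    (auto simp del: Image_singleton_iff
      intro!: congruent2I' cls_eqI[unfolded cls_def] lie_cong.plus_cong)

lemma cls_Brack: "s \<in> T \<Longrightarrow> t \<in> T \<Longrightarrow> cls (Brack s t) = \<lbrakk>cls s, cls t\<rbrakk>\<^bsub>P\<^esub>"
  unfolding lie_presented_def cls_def
  by (simp, rule UN_equiv_class2[OF equiv_lie_cong equiv_lie_cong, symmetric])
    (auto simp del: Image_singleton_iff
      intro!: congruent2I' cls_eqI[unfolded cls_def] lie_cong.brack_cong)

lemma cls_Scale: "c \<in> carrier K \<Longrightarrow> t \<in> T \<Longrightarrow> cls (Scale c t) = c \<odot>\<^bsub>P\<^esub> cls t"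
  unfolding lie_presented_def cls_def
  by (simp, rule UN_equiv_class[OF equiv_lie_cong, symmetric])
    (auto intro!: congruentI cls_eqI[unfolded cls_def] lie_cong.scale_cong)

lemmas cls_simps = cls_Zero cls_Plus cls_Scale cls_Brack
lemmas cls_folds = cls_simps[symmetric]

text \<open>Each axiom is checked on representatives: \<open>cls_folds\<close> gathers either side
  into the class of one term, and the congruence has a rule for that pair of terms.\<close>

sublocale presented: lie_algebra K P
proof -
  note [simp] = lie_terms.intros
  have "abelian_group P"
  proof (rule abelian_groupI)
    fix x assume "x \<in> carrier P"
    then obtain t where t: "t \<in> T" "x = cls t" by (auto simp: carrier_presented)
    have "cls (Scale (\<ominus> \<one>) t) \<oplus>\<^bsub>P\<^esub> x = \<zero>\<^bsub>P\<^esub>"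
      using t lie_cong.plus_neg[THEN cls_eqI, of t] by (simp add: cls_Zero cls_Plus)
    then show "\<exists>y\<in>carrier P. y \<oplus>\<^bsub>P\<^esub> x = \<zero>\<^bsub>P\<^esub>"
      using t by (intro bexI[of _ "cls (Scale (\<ominus> \<one>) t)"]) auto
  next
    fix x y assume "x \<in> carrier P" "y \<in> carrier P"
    then show "x \<oplus>\<^bsub>P\<^esub> y = y \<oplus>\<^bsub>P\<^esub> x"
      by (auto simp: carrier_presented cls_folds lie_cong.plus_comm[THEN cls_eqI])
  qed (auto simp: carrier_presented cls_folds lie_cong.plus_assoc[THEN cls_eqI]
      lie_cong.plus_zero[THEN cls_eqI])
  moreover have "module_axioms K P"
    by unfold_locales
      (auto simp: carrier_presented cls_folds
        lie_cong.scale_add_left[THEN cls_eqI] lie_cong.scale_add_right[THEN cls_eqI]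
        lie_cong.scale_mult[THEN cls_eqI] lie_cong.scale_one[THEN cls_eqI])
  ultimately have "module K P"
    by (intro module.intro is_cring)
  moreover have "lie_algebra_axioms K P"
    by unfold_locales
      (auto simp: bilinear_map_def carrier_presented cls_folds
        lie_cong.brack_add_left[THEN cls_eqI] lie_cong.brack_add_right[THEN cls_eqI]
        lie_cong.brack_scale_left[THEN cls_eqI] lie_cong.brack_scale_right[THEN cls_eqI]
        lie_cong.brack_self[THEN cls_eqI] lie_cong.brack_jacobi[THEN cls_eqI])
  ultimately show "lie_algebra K P"
    by (intro lie_algebra.intro field_axioms)
qed

end


section \<open>The tensor square\<close>

locale lie_tensor_square = lie_algebra K M
  for K :: "('k, 'r) ring_scheme" (structure)
    and M :: "('k, 'a, 'b) lie_alg_scheme" (structure)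
begin

sublocale lie_presentation K "carrier M \<times> carrier M" "tensor_rels K M" ..

abbreviation "Q \<equiv> tensor_square K M"
abbreviation bd where "bd \<equiv> bd_term M"
abbreviation tens (infixr \<open>\<otimes>\<^sub>M\<close> 72) where "m \<otimes>\<^sub>M n \<equiv> tensor K M m n"

sublocale Q: lie_algebra K Q
  unfolding tensor_square_def by (rule presented.lie_algebra_axioms)

section \<open>The boundary map on terms and on classes\<close>

lemma bd_closed [simp]: "t \<in> T \<Longrightarrow> bd t \<in> carrier M"
  by (induction rule: lie_terms.induct) auto

text \<open>The linear relations become bilinearity of the bracket of \<open>M\<close>, the two
  bracket relations become forms of the Jacobi identity, and \<open>bracket_tensor\<close> gets the
  same value on both sides by definition of \<open>bd\<close>.\<close>

lemma bd_rel: "(s, t) \<in> tensor_rels K M \<Longrightarrow> bd s = bd t"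
proof (induction rule: tensor_rels.induct)
  case (bracket_left m1 m2 m3)
  then show ?case
    by (simp add: bracket_bracket_left smult_minus_one M.minus_eq)
next
  case (bracket_right m1 m2 m3)
  \<comment> \<open>Antisymmetry brings the two terms of the relation to the shape of
    \<open>bracket_bracket_right\<close>.\<close>
  have "\<lbrakk>\<lbrakk>m3, m1\<rbrakk>\<^bsub>M\<^esub>, m2\<rbrakk>\<^bsub>M\<^esub> = \<lbrakk>m2, \<lbrakk>m1, m3\<rbrakk>\<^bsub>M\<^esub>\<rbrakk>\<^bsub>M\<^esub>"
    using bracket_right bracket_antisym[of "\<lbrakk>m3, m1\<rbrakk>\<^bsub>M\<^esub>" m2] bracket_antisym[of m3 m1]
    by (simp add: bracket_minus_right)
  moreover have "\<lbrakk>\<lbrakk>m2, m1\<rbrakk>\<^bsub>M\<^esub>, m3\<rbrakk>\<^bsub>M\<^esub> = \<ominus>\<^bsub>M\<^esub> \<lbrakk>\<lbrakk>m1, m2\<rbrakk>\<^bsub>M\<^esub>, m3\<rbrakk>\<^bsub>M\<^esub>"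
    using bracket_right bracket_antisym[of m2 m1] by (simp add: bracket_minus_left)
  ultimately show ?case
    using bracket_right bracket_bracket_right[of m1 m2 m3]
    by (simp add: smult_minus_one M.a_comm)
qed (simp_all add: bracket_add_left bracket_add_right bracket_smult_left bracket_smult_right)

text \<open>Apart from \<open>rel\<close> and the closure rules, the rules of the congruence are
  axioms of a Lie algebra, and those hold in \<open>M\<close>.\<close>

lemma bd_cong: "(s, t) \<in> C \<Longrightarrow> bd s = bd t"
proof (induction rule: lie_cong.induct)
  case (rel s t)
  then show ?case by (simp add: bd_rel)
next
  case (plus_neg t)
  then show ?case by (simp add: smult_minus_one M.l_neg)
next
  case (brack_jacobi s t u)
  then show ?case by (simp add: jacobi)
qed (simp_all add: M.a_ac smult_l_distr smult_r_distr smult_assoc1 bracket_self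
    bracket_add_left bracket_add_right bracket_smult_left bracket_smult_right)

text \<open>By \<open>bd_cong\<close> the boundary takes a single value on the class, which contains
  \<open>t\<close>, so \<open>the_elem\<close> returns that value.\<close>

lemma tensor_bd_cls:
  assumes "t \<in> T"
  shows "tensor_bd M (cls t) = bd t"
proof -
  have "bd ` cls t = {bd t}"
    using assms by (auto simp: cls_def dest: bd_cong intro: lie_cong.refl image_eqI[of _ _ t])
  then show ?thesis by (simp add: tensor_bd_def)
qed

section \<open>Symbols in the tensor square and their bilinearity\<close>

lemma tensor_cls: "m \<otimes>\<^sub>M n = cls (Gen (m, n))"
  by (simp add: tensor_def tensor_class_def cls_def)

lemma carrier_Q: "carrier Q = cls ` T"
  by (simp add: tensor_square_def carrier_presented)

lemmas cls_Q = cls_simps[folded tensor_square_def]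

lemma cls_closed_Q [simp]: "t \<in> T \<Longrightarrow> cls t \<in> carrier Q"
  by (simp add: carrier_Q)

lemma Gen_closed [simp]: "m \<in> carrier M \<Longrightarrow> n \<in> carrier M \<Longrightarrow> Gen (m, n) \<in> T"
  by (simp add: lie_terms.Gen)

lemma tensor_closed [simp]: "m \<in> carrier M \<Longrightarrow> n \<in> carrier M \<Longrightarrow> m \<otimes>\<^sub>M n \<in> carrier Q"
  by (simp add: tensor_cls)

lemma cls_rel: "(s, t) \<in> tensor_rels K M \<Longrightarrow> s \<in> T \<Longrightarrow> t \<in> T \<Longrightarrow> cls s = cls t"
  by (intro cls_eqI lie_cong.rel)

lemma tensor_bilinear: "bilinear_map K M M Q (tensor K M)"
  unfolding bilinear_map_def
  by (auto simp: tensor_cls cls_Q[symmetric] lie_terms.intros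
      tensor_rels.add_left[THEN cls_rel] tensor_rels.add_right[THEN cls_rel]
      tensor_rels.scale_left[THEN cls_rel, symmetric]
      tensor_rels.scale_right[THEN cls_rel, symmetric])

lemma tensor_add_left:
  "\<lbrakk>x \<in> carrier M; y \<in> carrier M; z \<in> carrier M\<rbrakk> \<Longrightarrow>
    (x \<oplus>\<^bsub>M\<^esub> y) \<otimes>\<^sub>M z = x \<otimes>\<^sub>M z \<oplus>\<^bsub>Q\<^esub> y \<otimes>\<^sub>M z"
  using tensor_bilinear by (simp add: bilinear_map_def)

lemma tensor_add_right:
  "\<lbrakk>x \<in> carrier M; y \<in> carrier M; z \<in> carrier M\<rbrakk> \<Longrightarrow>
    x \<otimes>\<^sub>M (y \<oplus>\<^bsub>M\<^esub> z) = x \<otimes>\<^sub>M y \<oplus>\<^bsub>Q\<^esub> x \<otimes>\<^sub>M z"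
  using tensor_bilinear by (simp add: bilinear_map_def)

lemma tensor_smult_left:
  "\<lbrakk>c \<in> carrier K; x \<in> carrier M; y \<in> carrier M\<rbrakk> \<Longrightarrow>
    (c \<odot>\<^bsub>M\<^esub> x) \<otimes>\<^sub>M y = c \<odot>\<^bsub>Q\<^esub> x \<otimes>\<^sub>M y"
  using tensor_bilinear by (simp add: bilinear_map_def)

lemma tensor_smult_right:
  "\<lbrakk>c \<in> carrier K; x \<in> carrier M; y \<in> carrier M\<rbrakk> \<Longrightarrow>
    x \<otimes>\<^sub>M (c \<odot>\<^bsub>M\<^esub> y) = c \<odot>\<^bsub>Q\<^esub> x \<otimes>\<^sub>M y"
  using tensor_bilinear by (simp add: bilinear_map_def)

lemma tensor_zero_left: "x \<in> carrier M \<Longrightarrow> \<zero>\<^bsub>M\<^esub> \<otimes>\<^sub>M x = \<zero>\<^bsub>Q\<^esub>"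
  using tensor_smult_left[of \<zero> "\<zero>\<^bsub>M\<^esub>" x] by simp

lemma tensor_zero_right: "x \<in> carrier M \<Longrightarrow> x \<otimes>\<^sub>M \<zero>\<^bsub>M\<^esub> = \<zero>\<^bsub>Q\<^esub>"
  using tensor_smult_right[of \<zero> x "\<zero>\<^bsub>M\<^esub>"] by simp

lemma tensor_minus_left:
  "x \<in> carrier M \<Longrightarrow> y \<in> carrier M \<Longrightarrow> (\<ominus>\<^bsub>M\<^esub> x) \<otimes>\<^sub>M y = \<ominus>\<^bsub>Q\<^esub> (x \<otimes>\<^sub>M y)"
  using tensor_smult_left[of "\<ominus> \<one>" x y] by (simp add: smult_minus_one Q.smult_minus_one)

lemma tensor_minus_right:
  "x \<in> carrier M \<Longrightarrow> y \<in> carrier M \<Longrightarrow> x \<otimes>\<^sub>M (\<ominus>\<^bsub>M\<^esub> y) = \<ominus>\<^bsub>Q\<^esub> (x \<otimes>\<^sub>M y)"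
  using tensor_smult_right[of "\<ominus> \<one>" x y] by (simp add: smult_minus_one Q.smult_minus_one)

section \<open>The bracket relations and the derivation rule\<close>

lemma tensor_bracket_left:
  assumes "a \<in> carrier M" "b \<in> carrier M" "c \<in> carrier M"
  shows "\<lbrakk>a, b\<rbrakk>\<^bsub>M\<^esub> \<otimes>\<^sub>M c = a \<otimes>\<^sub>M \<lbrakk>b, c\<rbrakk>\<^bsub>M\<^esub> \<ominus>\<^bsub>Q\<^esub> b \<otimes>\<^sub>M \<lbrakk>a, c\<rbrakk>\<^bsub>M\<^esub>"
  using cls_rel[OF tensor_rels.bracket_left[OF assms]] assms
  by (simp add: cls_Q lie_terms.intros tensor_cls Q.smult_minus_one Q.M.minus_eq)

lemma tensor_bracket_right:
  assumes "a \<in> carrier M" "b \<in> carrier M" "c \<in> carrier M"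
  shows "a \<otimes>\<^sub>M \<lbrakk>b, c\<rbrakk>\<^bsub>M\<^esub> = \<lbrakk>c, a\<rbrakk>\<^bsub>M\<^esub> \<otimes>\<^sub>M b \<ominus>\<^bsub>Q\<^esub> \<lbrakk>b, a\<rbrakk>\<^bsub>M\<^esub> \<otimes>\<^sub>M c"
  using cls_rel[OF tensor_rels.bracket_right[OF assms]] assms
  by (simp add: cls_Q lie_terms.intros tensor_cls Q.smult_minus_one Q.M.minus_eq)

lemma bracket_tensor_tensor:
  assumes "a \<in> carrier M" "b \<in> carrier M" "c \<in> carrier M" "d \<in> carrier M"
  shows "\<lbrakk>a \<otimes>\<^sub>M b, c \<otimes>\<^sub>M d\<rbrakk>\<^bsub>Q\<^esub> = \<lbrakk>a, b\<rbrakk>\<^bsub>M\<^esub> \<otimes>\<^sub>M \<lbrakk>c, d\<rbrakk>\<^bsub>M\<^esub>"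
  using cls_rel[OF tensor_rels.bracket_tensor[OF assms]] assms
  by (simp add: cls_Q lie_terms.intros tensor_cls)

lemma tensor_minus_bracket_left:
  assumes "a \<in> carrier M" "b \<in> carrier M" "c \<in> carrier M"
  shows "\<lbrakk>a, b\<rbrakk>\<^bsub>M\<^esub> \<otimes>\<^sub>M c = \<ominus>\<^bsub>Q\<^esub> (\<lbrakk>b, a\<rbrakk>\<^bsub>M\<^esub> \<otimes>\<^sub>M c)"
  using assms bracket_antisym[of a b] tensor_minus_left by simp

lemma tensor_minus_bracket_right:
  assumes "a \<in> carrier M" "b \<in> carrier M" "c \<in> carrier M"
  shows "c \<otimes>\<^sub>M \<lbrakk>a, b\<rbrakk>\<^bsub>M\<^esub> = \<ominus>\<^bsub>Q\<^esub> (c \<otimes>\<^sub>M \<lbrakk>b, a\<rbrakk>\<^bsub>M\<^esub>)"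
  using assms bracket_antisym[of a b] tensor_minus_right by simp

text \<open>A Jacobi identity for symbols. The first bracket relation expresses both terms on the
  right of the second one through \<open>p\<close>, \<open>q\<close> and \<open>r\<close>, so the
  second becomes an equation in these three alone.\<close>

lemma tensor_cyclic:
  assumes [simp]: "a \<in> carrier M" "b \<in> carrier M" "y \<in> carrier M"
  shows "y \<otimes>\<^sub>M \<lbrakk>a, b\<rbrakk>\<^bsub>M\<^esub> \<oplus>\<^bsub>Q\<^esub> (a \<otimes>\<^sub>M \<lbrakk>b, y\<rbrakk>\<^bsub>M\<^esub> \<oplus>\<^bsub>Q\<^esub> b \<otimes>\<^sub>M \<lbrakk>y, a\<rbrakk>\<^bsub>M\<^esub>) = \<zero>\<^bsub>Q\<^esub>"
proof -
  let ?p = "y \<otimes>\<^sub>M \<lbrakk>a, b\<rbrakk>\<^bsub>M\<^esub>" and ?q = "a \<otimes>\<^sub>M \<lbrakk>b, y\<rbrakk>\<^bsub>M\<^esub>" and ?r = "b \<otimes>\<^sub>M \<lbrakk>y, a\<rbrakk>\<^bsub>M\<^esub>"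
  have c: "?p \<in> carrier Q" "?q \<in> carrier Q" "?r \<in> carrier Q" by simp_all
  have 1: "\<lbrakk>b, y\<rbrakk>\<^bsub>M\<^esub> \<otimes>\<^sub>M a = ?r \<oplus>\<^bsub>Q\<^esub> ?p"
    using c tensor_minus_bracket_right[of b a y]
    by (simp add: tensor_bracket_left[of b y a] Q.M.minus_eq)
  have 2: "\<lbrakk>a, y\<rbrakk>\<^bsub>M\<^esub> \<otimes>\<^sub>M b = \<ominus>\<^bsub>Q\<^esub> ?q \<ominus>\<^bsub>Q\<^esub> ?p"
    using c tensor_minus_bracket_right[of y b a]
    by (simp add: tensor_bracket_left[of a y b])
  \<comment> \<open>The second bracket relation at \<open>y\<close>, \<open>a\<close>,
    \<open>b\<close>. Its right side is \<open>p + (p + q + r)\<close>, and cancelling one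
    \<open>p\<close> leaves the claim.\<close>
  have "?p = (?r \<oplus>\<^bsub>Q\<^esub> ?p) \<ominus>\<^bsub>Q\<^esub> (\<ominus>\<^bsub>Q\<^esub> ?q \<ominus>\<^bsub>Q\<^esub> ?p)"
    using tensor_bracket_right[of y a b] 1 2 by simp
  also have "\<dots> = ?p \<oplus>\<^bsub>Q\<^esub> (?p \<oplus>\<^bsub>Q\<^esub> (?q \<oplus>\<^bsub>Q\<^esub> ?r))"
    using c by (simp add: Q.abelian_simps)
  finally show ?thesis
    using c by (metis Q.M.add.r_cancel_one' Q.M.a_closed Q.M.a_comm)
qed

text \<open>The first relation turns the left side into \<open>q + r\<close>, which is
  \<open>-p\<close> by the cyclic identity. One argument has to be a bracket: no sign rule for
  arbitrary symbols is claimed.\<close>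

lemma bracket_tensor_antisym:
  assumes [simp]: "a \<in> carrier M" "b \<in> carrier M" "y \<in> carrier M"
  shows "\<lbrakk>a, b\<rbrakk>\<^bsub>M\<^esub> \<otimes>\<^sub>M y = \<ominus>\<^bsub>Q\<^esub> (y \<otimes>\<^sub>M \<lbrakk>a, b\<rbrakk>\<^bsub>M\<^esub>)"
proof -
  have "\<lbrakk>a, b\<rbrakk>\<^bsub>M\<^esub> \<otimes>\<^sub>M y = a \<otimes>\<^sub>M \<lbrakk>b, y\<rbrakk>\<^bsub>M\<^esub> \<oplus>\<^bsub>Q\<^esub> b \<otimes>\<^sub>M \<lbrakk>y, a\<rbrakk>\<^bsub>M\<^esub>"
    using tensor_minus_bracket_right[of a y b]
    by (simp add: tensor_bracket_left Q.M.minus_eq)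
  also have "\<dots> = \<ominus>\<^bsub>Q\<^esub> (y \<otimes>\<^sub>M \<lbrakk>a, b\<rbrakk>\<^bsub>M\<^esub>)"
    using tensor_cyclic[of a b y]
    by (intro Q.M.minus_equality[symmetric]) (simp_all add: Q.M.a_comm)
  finally show ?thesis .
qed

text \<open>The second bracket relation with its signs absorbed. The right side is the prescribed
  action of \<open>n\<close> on the symbol of \<open>a\<close> and \<open>b\<close>, whose boundary
  is \<open>[a, b]\<close>; this links the action to the boundary.\<close>

lemma tensor_bracket_derivation:
  assumes [simp]: "n \<in> carrier M" "a \<in> carrier M" "b \<in> carrier M"
  shows "n \<otimes>\<^sub>M \<lbrakk>a, b\<rbrakk>\<^bsub>M\<^esub> = \<lbrakk>n, a\<rbrakk>\<^bsub>M\<^esub> \<otimes>\<^sub>M b \<oplus>\<^bsub>Q\<^esub> a \<otimes>\<^sub>M \<lbrakk>n, b\<rbrakk>\<^bsub>M\<^esub>"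
proof -
  have "a \<otimes>\<^sub>M \<lbrakk>n, b\<rbrakk>\<^bsub>M\<^esub> = \<lbrakk>b, n\<rbrakk>\<^bsub>M\<^esub> \<otimes>\<^sub>M a"
    using bracket_tensor_antisym[of n b a] tensor_minus_bracket_left[of b n a] by simp
  then show ?thesis
    using tensor_minus_bracket_left[of n a b]
    by (simp add: tensor_bracket_right[of n a b] Q.M.minus_eq Q.M.a_comm)
qed

section \<open>The bracket of the tensor square in terms of the boundary\<close>

text \<open>First half of the bracket formula: the left factor is a symbol and the induction runs
  over the right one. The symbol stays arbitrary, because the bracket case reuses the hypotheses
  with \<open>[a, b]\<close> and a boundary value as its entries.\<close>

lemma bracket_tensor_cls:
  assumes "t \<in> T" "a \<in> carrier M" "b \<in> carrier M"
  shows "\<lbrakk>a \<otimes>\<^sub>M b, cls t\<rbrakk>\<^bsub>Q\<^esub> = \<lbrakk>a, b\<rbrakk>\<^bsub>M\<^esub> \<otimes>\<^sub>M bd t"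
  using assms
proof (induction arbitrary: a b rule: lie_terms.induct)
  case (Gen x)
  then show ?case by (cases x) (auto simp: bracket_tensor_tensor tensor_cls[symmetric])
next
  case (Brack s t)
  then have [simp]: "a \<in> carrier M" "b \<in> carrier M" "s \<in> T" "t \<in> T" by auto
  have "\<lbrakk>a \<otimes>\<^sub>M b, cls (Brack s t)\<rbrakk>\<^bsub>Q\<^esub>
      = \<lbrakk>\<lbrakk>a \<otimes>\<^sub>M b, cls s\<rbrakk>\<^bsub>Q\<^esub>, cls t\<rbrakk>\<^bsub>Q\<^esub> \<oplus>\<^bsub>Q\<^esub> \<lbrakk>cls s, \<lbrakk>a \<otimes>\<^sub>M b, cls t\<rbrakk>\<^bsub>Q\<^esub>\<rbrakk>\<^bsub>Q\<^esub>"
    using Q.bracket_bracket_right[of "a \<otimes>\<^sub>M b" "cls s" "cls t"] by (simp add: cls_Q)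
  \<comment> \<open>The inner brackets are symbols by induction; antisymmetry moves the second one
    to the left, where the hypothesis applies again.\<close>
  also have "\<dots> = \<lbrakk>\<lbrakk>a, b\<rbrakk>\<^bsub>M\<^esub> \<otimes>\<^sub>M bd s, cls t\<rbrakk>\<^bsub>Q\<^esub>
      \<ominus>\<^bsub>Q\<^esub> \<lbrakk>\<lbrakk>a, b\<rbrakk>\<^bsub>M\<^esub> \<otimes>\<^sub>M bd t, cls s\<rbrakk>\<^bsub>Q\<^esub>"
    using Q.bracket_antisym[of "cls s" "\<lbrakk>a, b\<rbrakk>\<^bsub>M\<^esub> \<otimes>\<^sub>M bd t"] by (simp add: Brack Q.M.minus_eq)
  also have "\<dots> = \<lbrakk>\<lbrakk>a, b\<rbrakk>\<^bsub>M\<^esub>, bd s\<rbrakk>\<^bsub>M\<^esub> \<otimes>\<^sub>M bd t \<ominus>\<^bsub>Q\<^esub> \<lbrakk>\<lbrakk>a, b\<rbrakk>\<^bsub>M\<^esub>, bd t\<rbrakk>\<^bsub>M\<^esub> \<otimes>\<^sub>M bd s"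
    by (simp add: Brack)
  \<comment> \<open>The derivation rule for \<open>n = [a, b]\<close>, with its second summand
    reversed by \<open>bracket_tensor_antisym\<close>.\<close>
  also have "\<dots> = \<lbrakk>a, b\<rbrakk>\<^bsub>M\<^esub> \<otimes>\<^sub>M \<lbrakk>bd s, bd t\<rbrakk>\<^bsub>M\<^esub>"
    by (simp add: tensor_bracket_derivation[of _ "bd s"] Q.M.minus_eq
        bracket_tensor_antisym[of "\<lbrakk>a, b\<rbrakk>\<^bsub>M\<^esub>" "bd t" "bd s"])
  finally show ?case by simp
qed (simp_all add: cls_Q tensor_zero_right tensor_add_right tensor_smult_right
    Q.bracket_zero_right Q.bracket_add_right Q.bracket_smult_right)

text \<open>Second half, by induction on the left factor. The Jacobi identity moves a bracket on the
  left over to the right factor, which is why \<open>t\<close> is arbitrary; the values then combine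
  by the first bracket relation.\<close>

lemma bracket_cls:
  assumes "s \<in> T" "t \<in> T"
  shows "\<lbrakk>cls s, cls t\<rbrakk>\<^bsub>Q\<^esub> = bd s \<otimes>\<^sub>M bd t"
  using assms
proof (induction arbitrary: t rule: lie_terms.induct)
  case (Gen x)
  then show ?case by (cases x) (auto simp: bracket_tensor_cls tensor_cls[symmetric])
next
  case (Brack s1 s2)
  then have [simp]: "s1 \<in> T" "s2 \<in> T" "t \<in> T" by auto
  have "\<lbrakk>cls (Brack s1 s2), cls t\<rbrakk>\<^bsub>Q\<^esub>
      = \<lbrakk>cls s1, cls (Brack s2 t)\<rbrakk>\<^bsub>Q\<^esub> \<ominus>\<^bsub>Q\<^esub> \<lbrakk>cls s2, cls (Brack s1 t)\<rbrakk>\<^bsub>Q\<^esub>"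
    by (simp add: cls_Q Q.bracket_bracket_left)
  also have "\<dots> = \<lbrakk>bd s1, bd s2\<rbrakk>\<^bsub>M\<^esub> \<otimes>\<^sub>M bd t"
    by (simp add: Brack.IH lie_terms.Brack tensor_bracket_left)
  finally show ?case by simp
qed (simp_all add: cls_Q tensor_zero_left tensor_add_left tensor_smult_left
    Q.bracket_zero_left Q.bracket_add_left Q.bracket_smult_left)

section \<open>The action on terms and on classes\<close>

lemma act_term_closed [simp]: "t \<in> T \<Longrightarrow> m \<in> carrier M \<Longrightarrow> act_term M m t \<in> T"
  by (induction rule: lie_terms.induct) (auto intro!: lie_terms.intros)

lemma bd_act_term:
  "t \<in> T \<Longrightarrow> m \<in> carrier M \<Longrightarrow> bd (act_term M m t) = \<lbrakk>m, bd t\<rbrakk>\<^bsub>M\<^esub>"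
  by (induction rule: lie_terms.induct)
    (auto simp: bracket_zero_right bracket_add_right bracket_smult_right
      bracket_bracket_right[symmetric])

text \<open>On generators this is the derivation rule; on brackets \<open>bracket_cls\<close>
  reduces it to the same rule for boundary values. It spares a check of the action against each
  relation, since the right side depends on \<open>t\<close> only through
  \<open>bd t\<close>.\<close>

lemma cls_act_term:
  assumes "t \<in> T" "m \<in> carrier M"
  shows "cls (act_term M m t) = m \<otimes>\<^sub>M bd t"
  using assms
proof (induction rule: lie_terms.induct)
  case (Gen x)
  then obtain a b where "x = (a, b)" "a \<in> carrier M" "b \<in> carrier M" by auto
  then show ?case
    using Gen tensor_bracket_derivation[of m a b] by (simp add: cls_Q tensor_cls)
next
  case (Brack s t)
  then have [simp]: "s \<in> T" "t \<in> T" "m \<in> carrier M" by auto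
  show ?case
    using bracket_cls[of "act_term M m s" t] bracket_cls[of s "act_term M m t"]
      tensor_bracket_derivation[of m "bd s" "bd t"]
    by (simp add: cls_Q lie_terms.Brack bd_act_term)
qed (simp_all add: cls_Q tensor_zero_right tensor_add_right tensor_smult_right)

lemma tensor_act_cls:
  assumes "t \<in> T" "m \<in> carrier M"
  shows "tensor_act K M m (cls t) = m \<otimes>\<^sub>M bd t"
proof -
  have "tensor_class K M (act_term M m s) = m \<otimes>\<^sub>M bd t" if "s \<in> cls t" for s
    using that assms lie_cong_terms[of t s] bd_cong[of t s]
    by (simp add: tensor_class_def cls_act_term[unfolded cls_def] cls_def)
  moreover have "t \<in> cls t" using assms by (auto simp: cls_def intro: lie_cong.refl)
  ultimately show ?thesis by (auto simp: tensor_act_def)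
qed

section \<open>The formulas for elements of the tensor square\<close>

lemma tensor_bd_tensor:
  "m \<in> carrier M \<Longrightarrow> n \<in> carrier M \<Longrightarrow> tensor_bd M (m \<otimes>\<^sub>M n) = \<lbrakk>m, n\<rbrakk>\<^bsub>M\<^esub>"
  by (simp add: tensor_cls tensor_bd_cls)

lemma tensor_bd_hom: "tensor_bd M \<in> lie_hom K Q M"
  by (auto simp: lie_hom_def carrier_Q tensor_bd_cls cls_Q[symmetric] lie_terms.intros)

lemma tensor_bd_closed [simp]: "x \<in> carrier Q \<Longrightarrow> tensor_bd M x \<in> carrier M"
  by (auto simp: carrier_Q tensor_bd_cls)

lemma tensor_act_eq:
  "m \<in> carrier M \<Longrightarrow> x \<in> carrier Q \<Longrightarrow> tensor_act K M m x = m \<otimes>\<^sub>M tensor_bd M x"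
  by (auto simp: carrier_Q tensor_bd_cls tensor_act_cls)

lemma bracket_Q_eq:
  "x \<in> carrier Q \<Longrightarrow> y \<in> carrier Q \<Longrightarrow> \<lbrakk>x, y\<rbrakk>\<^bsub>Q\<^esub> = tensor_bd M x \<otimes>\<^sub>M tensor_bd M y"
  by (auto simp: carrier_Q tensor_bd_cls bracket_cls)

text \<open>Boundary values are built linearly from brackets, so
  \<open>bracket_tensor_antisym\<close> extends to them. This gives the axiom
  \<open>br_bd_left\<close>, the one with a sign.\<close>

lemma tensor_bd_antisym:
  assumes "x \<in> carrier Q" "n \<in> carrier M"
  shows "tensor_bd M x \<otimes>\<^sub>M n = \<ominus>\<^bsub>Q\<^esub> (n \<otimes>\<^sub>M tensor_bd M x)"
proof -
  have "bd t \<otimes>\<^sub>M n = \<ominus>\<^bsub>Q\<^esub> (n \<otimes>\<^sub>M bd t)" if "t \<in> T" for t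
    using that assms(2)
  proof (induction rule: lie_terms.induct)
    case (Gen x)
    then show ?case by (cases x) (auto simp: bracket_tensor_antisym)
  next
    case Zero
    have "\<zero>\<^bsub>Q\<^esub> = \<ominus>\<^bsub>Q\<^esub> \<zero>\<^bsub>Q\<^esub>"
      by (rule Q.M.minus_equality[symmetric]) auto
    then show ?case using Zero by (simp add: tensor_zero_left tensor_zero_right)
  qed (simp_all add: bracket_tensor_antisym
      tensor_add_left tensor_add_right tensor_smult_left tensor_smult_right
      Q.M.minus_add Q.smult_r_minus)
  then show ?thesis using assms by (auto simp: carrier_Q tensor_bd_cls)
qed

section \<open>Verification of the axioms\<close>

text \<open>Once \<open>tensor_act_eq\<close>, \<open>bracket_Q_eq\<close> and
  \<open>tensor_bd_tensor\<close> have removed the action and the bracket of \<open>Q\<close>, each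
  remaining axiom is an identity between symbols with boundary values as entries.\<close>

lemma lie_braiding_tensor:
  "lie_braiding K Q M (tensor_act K M) (tensor_bd M) (\<lambda>m1 m2. tensor K M m1 m2)"
proof -
  have hom: "tensor_bd M (x \<oplus>\<^bsub>Q\<^esub> y) = tensor_bd M x \<oplus>\<^bsub>M\<^esub> tensor_bd M y"
      "tensor_bd M \<lbrakk>x, y\<rbrakk>\<^bsub>Q\<^esub> = \<lbrakk>tensor_bd M x, tensor_bd M y\<rbrakk>\<^bsub>M\<^esub>"
    if "x \<in> carrier Q" "y \<in> carrier Q" for x y
    using that tensor_bd_hom by (auto simp: lie_hom_def)
  have hom_smult: "tensor_bd M (c \<odot>\<^bsub>Q\<^esub> x) = c \<odot>\<^bsub>M\<^esub> tensor_bd M x"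
    if "c \<in> carrier K" "x \<in> carrier Q" for c x
    using that tensor_bd_hom by (auto simp: lie_hom_def)
  have "lie_action_axioms K M Q (tensor_act K M)"
  proof
    show "bilinear_map K M Q Q (tensor_act K M)"
      by (simp add: bilinear_map_def tensor_act_eq hom hom_smult tensor_add_left
          tensor_add_right tensor_smult_left tensor_smult_right)
  next
    fix n x y assume "n \<in> carrier M" "x \<in> carrier Q" "y \<in> carrier Q"
    then show "tensor_act K M n \<lbrakk>x, y\<rbrakk>\<^bsub>Q\<^esub>
        = \<lbrakk>tensor_act K M n x, y\<rbrakk>\<^bsub>Q\<^esub> \<oplus>\<^bsub>Q\<^esub> \<lbrakk>x, tensor_act K M n y\<rbrakk>\<^bsub>Q\<^esub>"
      using tensor_bracket_derivation[of n "tensor_bd M x" "tensor_bd M y"]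
      by (simp add: tensor_act_eq bracket_Q_eq tensor_bd_tensor)
  \<comment> \<open>For \<open>bracket_act\<close>, acting twice gives the symbol of
    \<open>n\<close> and \<open>[n', \<partial> x]\<close>, so the axiom is the first bracket
    relation.\<close>
  qed (simp_all add: tensor_act_eq tensor_bd_tensor tensor_bracket_left)
  then have "lie_action K M Q (tensor_act K M)"
    by (intro lie_action.intro Q.lie_algebra_axioms lie_algebra_axioms)
  moreover have "lie_crossed_module_axioms K Q M (tensor_act K M) (tensor_bd M)"
    \<comment> \<open>In the Peiffer identity both sides are the symbol of
      \<open>\<partial> x\<close> and \<open>\<partial> y\<close>.\<close>
    by unfold_locales
      (simp_all add: tensor_bd_hom tensor_act_eq tensor_bd_tensor bracket_Q_eq)
  ultimately have "lie_crossed_module K Q M (tensor_act K M) (tensor_bd M)"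
    by (intro lie_crossed_module.intro)
  moreover have
    "lie_braiding_axioms K Q M (tensor_act K M) (tensor_bd M) (\<lambda>m1 m2. tensor K M m1 m2)"
  proof
    fix n n' n'' assume [simp]: "n \<in> carrier M" "n' \<in> carrier M" "n'' \<in> carrier M"
    \<comment> \<open>The derivation rule, with the symbol of \<open>n'\<close> and
      \<open>[n, n'']\<close> reversed at the cost of a sign.\<close>
    show "n \<otimes>\<^sub>M \<lbrakk>n', n''\<rbrakk>\<^bsub>M\<^esub> = \<lbrakk>n, n'\<rbrakk>\<^bsub>M\<^esub> \<otimes>\<^sub>M n'' \<ominus>\<^bsub>Q\<^esub> \<lbrakk>n, n''\<rbrakk>\<^bsub>M\<^esub> \<otimes>\<^sub>M n'"
      using tensor_bracket_derivation[of n n' n'']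
      by (simp add: bracket_tensor_antisym[of n n'' n'] Q.M.minus_eq)
  next
    fix x n assume "x \<in> carrier Q" "n \<in> carrier M"
    then show "tensor_bd M x \<otimes>\<^sub>M n = \<ominus>\<^bsub>Q\<^esub> tensor_act K M n x"
      by (simp add: tensor_act_eq tensor_bd_antisym)
  \<comment> \<open>Here \<open>br_bd_bd\<close> is the bracket formula, \<open>br_bd_right\<close>
    the action formula and \<open>br_bracket_left\<close> the first bracket relation.\<close>
  qed (simp_all add: tensor_bilinear tensor_bd_tensor bracket_Q_eq tensor_act_eq
      tensor_bracket_left)
  ultimately show ?thesis
    by (intro lie_braiding.intro)
qed

end

theorem mainTheorem5:
  fixes K :: "('k, 'r) ring_scheme"
    and M :: "('k, 'a, 'b) lie_alg_scheme"
  assumes "field K" and "lie_algebra K M"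
  shows "lie_braiding K (tensor_square K M) M (tensor_act K M) (tensor_bd M)
           (\<lambda>m1 m2. tensor K M m1 m2)"
proof -
  interpret lie_tensor_square K M
    using assms(2) by (rule lie_tensor_square.intro)
  show ?thesis by (rule lie_braiding_tensor)
qed

end
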